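(* For any scalars $\varepsilon_\pm\in\mathbb C$ and $g_{k+1}\in\mathbb C$ ($k\in\mathbb N$), with $g_0=\rho/(q-q^{-1})$, there is an algebra map $\epsilon:\mathcal A_q\to\mathbb C$ given by $$\epsilon(\mathsf G_{k+1})=\epsilon(\tilde{\mathsf G}_{k+1})=g_{k+1},\qquad \epsilon(\mathsf W_{k+1})=g_0^{-1}\sum_{m=0}^k\big(\overline m\,\varepsilon_++\overline{m+1}\,\varepsilon_-\big)g_{k-m},\qquad \epsilon(\mathsf W_{-k})=\epsilon(\mathsf W_{k+1})\big|_{\varepsilon_\pm\to\varepsilon_\mp},\qquad k\in\mathbb N.$$
   Context: $q\in\mathbb C^*$ is not a root of unity, $\mathbb N=\{0,1,\dots\}$, $\overline m=m\bmod 2\in\{0,1\}$, $[X,Y]=XY-YX$, $[X,Y]_q=qXY-q^{-1}YX$. Fix $k_\pm\in\mathbb C^*$, $\rho=k_+k_-(q+q^{-1})^2$. $\mathcal A_q$ is the unital associative $\mathbb C$-algebra generated by $\mathsf W_{-k},\mathsf W_{k+1},\mathsf G_{k+1},\tilde{\mathsf G}_{k+1}$ ($k\in\mathbb N$) with, for all $k,l\in\mathbb N$: $[\mathsf W_0,\mathsf W_{k+1}]=[\mathsf W_{-k},\mathsf W_1]=\frac{\tilde{\mathsf G}_{k+1}-\mathsf G_{k+1}}{q+q^{-1}}$; $[\mathsf W_0,\mathsf G_{k+1}]_q=[\tilde{\mathsf G}_{k+1},\mathsf W_0]_q=\rho(\mathsf W_{-k-1}-\mathsf W_{k+1})$; $[\mathsf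 G_{k+1},\mathsf W_1]_q=[\mathsf W_1,\tilde{\mathsf G}_{k+1}]_q=\rho(\mathsf W_{k+2}-\mathsf W_{-k})$; $[\mathsf W_{-k},\mathsf W_{-l}]=[\mathsf W_{k+1},\mathsf W_{l+1}]=[\mathsf G_{k+1},\mathsf G_{l+1}]=[\tilde{\mathsf G}_{k+1},\tilde{\mathsf G}_{l+1}]=0$; $[\mathsf W_{-k},\mathsf W_{l+1}]+[\mathsf W_{k+1},\mathsf W_{-l}]=0$; $[\mathsf W_{-k},\mathsf G_{l+1}]+[\mathsf G_{k+1},\mathsf W_{-l}]=0$; $[\mathsf W_{-k},\tilde{\mathsf G}_{l+1}]+[\tilde{\mathsf G}_{k+1},\mathsf W_{-l}]=0$; $[\mathsf W_{k+1},\mathsf G_{l+1}]+[\mathsf G_{k+1},\mathsf W_{l+1}]=0$; $[\mathsf W_{k+1},\tilde{\mathsf G}_{l+1}]+[\tilde{\mathsf G}_{k+1},\mathsf W_{l+1}]=0$; $[\tilde{\mathsf G}_{k+1},\mathsf G_{l+1}]+[\mathsf G_{k+1},\tilde{\mathsf G}_{l+1}]=0$. *)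

theory Defs
  imports
    Complex_Main
    "HOL-Library.Poly_Mapping"
    "HOL-Algebra.QuotRing"
    "HOL-Algebra.Module"
    "HOL-Algebra.Algebraic_Closure_Type"
begin

text \<open>
  The free monoid, written additively because the convolution product on
  \<^typ>\<open>'a \<Rightarrow>\<^sub>0 'b\<close> is indexed by an additive (here: noncommutative) monoid.
  The free unital associative algebra is then the algebra of finitely supported
  functions on words.
\<close>

datatype 'a word = Word (letters: "'a list")

instantiation word :: (type) monoid_add
begin

definition zero_word :: "'a word" where
  "zero_word = Word []"

definition plus_word :: "'a word \<Rightarrow> 'a word \<Rightarrow> 'a word" where
  "plus_word u v = Word (letters u @ letters v)"

instance
  by standard (simp_all add: zero_word_def plus_word_def)

end

type_synonym 'a free_alg = "'a word \<Rightarrow>\<^sub>0 complex"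

definition free_gen :: "'a \<Rightarrow> 'a free_alg" where
  "free_gen x = Poly_Mapping.single (Word [x]) 1"

definition scalar :: "complex \<Rightarrow> 'a free_alg" where
  "scalar c = Poly_Mapping.single 0 c"

definition comm :: "'a free_alg \<Rightarrow> 'a free_alg \<Rightarrow> 'a free_alg" where
  "comm u v = u * v - v * u"

definition qcomm :: "complex \<Rightarrow> 'a free_alg \<Rightarrow> 'a free_alg \<Rightarrow> 'a free_alg" where
  "qcomm q u v = scalar q * (u * v) - scalar (inverse q) * (v * u)"

text \<open>
  The W-generators form one family indexed by all integers: \<open>W (- int k)\<close> and
  \<open>W (int k + 1)\<close> for natural \<open>k\<close>. The other two families are shifted by one:
  \<open>G k\<close> and \<open>Gt k\<close> stand for the generators of index \<open>k + 1\<close>.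
\<close>

datatype gen = W int | G nat | Gt nat

abbreviation xW :: "int \<Rightarrow> gen free_alg" where "xW n \<equiv> free_gen (W n)"
abbreviation xG :: "nat \<Rightarrow> gen free_alg" where "xG k \<equiv> free_gen (G k)"
abbreviation xGt :: "nat \<Rightarrow> gen free_alg" where "xGt k \<equiv> free_gen (Gt k)"

definition rho :: "complex \<Rightarrow> complex \<Rightarrow> complex \<Rightarrow> complex" where
  "rho q kp km = kp * km * (q + inverse q)\<^sup>2"

text \<open>A chain of equalities \<open>a = b = c\<close> is given as the two relations \<open>a = c\<close> and \<open>b = c\<close>.\<close>

inductive Aq_rel :: "complex \<Rightarrow> complex \<Rightarrow> complex \<Rightarrow> gen free_alg \<Rightarrow> gen free_alg \<Rightarrow> bool"
  for q kp km :: complex where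
  "Aq_rel q kp km (comm (xW 0) (xW (int k + 1)))
     (scalar (1 / (q + inverse q)) * (xGt k - xG k))"
| "Aq_rel q kp km (comm (xW (- int k)) (xW 1))
     (scalar (1 / (q + inverse q)) * (xGt k - xG k))"
| "Aq_rel q kp km (qcomm q (xW 0) (xG k))
     (scalar (rho q kp km) * (xW (- int k - 1) - xW (int k + 1)))"
| "Aq_rel q kp km (qcomm q (xGt k) (xW 0))
     (scalar (rho q kp km) * (xW (- int k - 1) - xW (int k + 1)))"
| "Aq_rel q kp km (qcomm q (xG k) (xW 1))
     (scalar (rho q kp km) * (xW (int k + 2) - xW (- int k)))"
| "Aq_rel q kp km (qcomm q (xW 1) (xGt k))
     (scalar (rho q kp km) * (xW (int k + 2) - xW (- int k)))"
| "Aq_rel q kp km (comm (xW (- int k)) (xW (- int l))) 0"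
| "Aq_rel q kp km (comm (xW (int k + 1)) (xW (int l + 1))) 0"
| "Aq_rel q kp km (comm (xG k) (xG l)) 0"
| "Aq_rel q kp km (comm (xGt k) (xGt l)) 0"
| "Aq_rel q kp km (comm (xW (- int k)) (xW (int l + 1)) + comm (xW (int k + 1)) (xW (- int l))) 0"
| "Aq_rel q kp km (comm (xW (- int k)) (xG l) + comm (xG k) (xW (- int l))) 0"
| "Aq_rel q kp km (comm (xW (- int k)) (xGt l) + comm (xGt k) (xW (- int l))) 0"
| "Aq_rel q kp km (comm (xW (int k + 1)) (xG l) + comm (xG k) (xW (int l + 1))) 0"
| "Aq_rel q kp km (comm (xW (int k + 1)) (xGt l) + comm (xGt k) (xW (int l + 1))) 0"
| "Aq_rel q kp km (comm (xGt k) (xG l) + comm (xG k) (xGt l)) 0"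

definition Aq_ideal :: "complex \<Rightarrow> complex \<Rightarrow> complex \<Rightarrow> gen free_alg set" where
  "Aq_ideal q kp km =
     genideal ring_of_type_algebra {x - y | x y. Aq_rel q kp km x y}"

definition Aq_class :: "complex \<Rightarrow> complex \<Rightarrow> complex \<Rightarrow> gen free_alg \<Rightarrow> gen free_alg set" where
  "Aq_class q kp km x = Aq_ideal q kp km +>\<^bsub>ring_of_type_algebra\<^esub> x"

definition Aq :: "complex \<Rightarrow> complex \<Rightarrow> complex \<Rightarrow> (complex, gen free_alg set) module" where
  "Aq q kp km =
     (let R = ring_of_type_algebra Quot Aq_ideal q kp km
      in \<lparr>carrier = carrier R, monoid.mult = monoid.mult R, one = one R, zero = zero R, add = add R,
           module.smult = (\<lambda>c x. Aq_class q kp km (scalar c) \<otimes>\<^bsub>R\<^esub> x)\<rparr>)"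

definition complex_alg :: "(complex, complex) module" where
  "complex_alg = \<lparr>carrier = UNIV, monoid.mult = (*), one = 1, zero = 0, add = (+), module.smult = (*)\<rparr>"

text \<open>The library's \<open>algebra\<close> locale covers only commutative algebras.\<close>

definition alg_hom ::
    "(complex, 'a, 'm) module_scheme \<Rightarrow> (complex, 'b, 'n) module_scheme \<Rightarrow> ('a \<Rightarrow> 'b) set" where
  "alg_hom A B = {h \<in> ring_hom A B.
     \<forall>c. \<forall>x\<in>carrier A. h (c \<odot>\<^bsub>A\<^esub> x) = c \<odot>\<^bsub>B\<^esub> h x}"

abbreviation W_A :: "complex \<Rightarrow> complex \<Rightarrow> complex \<Rightarrow> int \<Rightarrow> gen free_alg set" where
  "W_A q kp km n \<equiv> Aq_class q kp km (xW n)"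

abbreviation G_A :: "complex \<Rightarrow> complex \<Rightarrow> complex \<Rightarrow> nat \<Rightarrow> gen free_alg set" where
  "G_A q kp km k \<equiv> Aq_class q kp km (xG k)"

abbreviation Gt_A :: "complex \<Rightarrow> complex \<Rightarrow> complex \<Rightarrow> nat \<Rightarrow> gen free_alg set" where
  "Gt_A q kp km k \<equiv> Aq_class q kp km (xGt k)"

lemma free_alg_ring: "ring (ring_of_type_algebra :: 'a free_alg ring)"
proof unfold_locales
  have "\<exists>y. y + x = 0 \<and> x + y = 0" for x :: "'a free_alg"
    by (intro exI[of _ "- x"]) simp
  then show "carrier (add_monoid (ring_of_type_algebra :: 'a free_alg ring))
      \<subseteq> Units (add_monoid ring_of_type_algebra)"
    by (auto simp: Units_def ring_of_type_algebra_def)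
qed (auto simp: ring_of_type_algebra_def algebra_simps)

lemma Aq_ideal_ideal: "ideal (Aq_ideal q kp km) ring_of_type_algebra"
  unfolding Aq_ideal_def
  by (rule ring.genideal_ideal[OF free_alg_ring]) (simp add: ring_of_type_algebra_def)

lemma Aq_ring: "ring (Aq q kp km)"
proof -
  interpret R: ring "ring_of_type_algebra Quot Aq_ideal q kp km"
    by (rule ideal.quotient_is_ring[OF Aq_ideal_ideal])
  show ?thesis
    unfolding Aq_def Let_def
    by unfold_locales
      (use R.add.Units in \<open>auto simp: R.m_assoc R.a_ac R.l_distr R.r_distr Units_def\<close>)
qed

lemma Aq_class_eq_of_rel:
  assumes "Aq_rel q kp km x y"
  shows "Aq_class q kp km x = Aq_class q kp km y"
proof -
  let ?F = "ring_of_type_algebra :: gen free_alg ring"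
  interpret ideal "Aq_ideal q kp km" ?F by (rule Aq_ideal_ideal)
  have "x - y \<in> Aq_ideal q kp km"
    unfolding Aq_ideal_def
    using ring.genideal_self[OF free_alg_ring, of "{x - y | x y. Aq_rel q kp km x y}"] assms
    by (auto simp: ring_of_type_algebra_def)
  then have "x \<in> Aq_ideal q kp km +>\<^bsub>?F\<^esub> y"
    by (force simp: a_r_coset_def r_coset_def ring_of_type_algebra_def)
  then show ?thesis
    unfolding Aq_class_def
    by (metis a_repr_independence a_subgroup UNIV_I ring_of_type_algebra_def partial_object.select_convs(1))
qed

lemma Aq_smult_class:
  "c \<odot>\<^bsub>Aq q kp km\<^esub> Aq_class q kp km x = Aq_class q kp km (scalar c * x)"
  using ideal.rcoset_mult_add[OF Aq_ideal_ideal, of "scalar c" x q kp km]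
  by (simp add: Aq_def Let_def FactRing_def Aq_class_def ring_of_type_algebra_def)

end

theory Submission
  imports Defs
begin

text \<open>
  A character of the free algebra is determined by arbitrary values on the generators, and it
  descends to \<open>\<A>\<^sub>q\<close> as soon as it identifies the two sides of every defining relation. Since \<open>\<complex>\<close> is
  commutative, every commutator is sent to \<open>0\<close>; the relations between commutators therefore only
  ask that \<open>G\<^sub>k\<^sub>+\<^sub>1\<close> and its tilde partner have the same image, while a \<open>q\<close>-commutator is sent
  to \<open>(q - q\<^sup>-\<^sup>1)\<close> times the product of the images.

  Write \<open>w\<^sub>k\<close> for the proposed value on \<open>W\<^sub>k\<^sub>+\<^sub>1\<close> and \<open>v\<^sub>k\<close> for the one on \<open>W\<^sub>-\<^sub>k\<close>. As
  \<open>\<rho> = g\<^sub>0 (q - q\<^sup>-\<^sup>1)\<close>, the remaining relations become the pair of recursions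
  \<open>g\<^sub>0 (v\<^sub>k\<^sub>+\<^sub>1 - w\<^sub>k) = \<epsilon>\<^sub>+ g\<^sub>k\<^sub>+\<^sub>1\<close> and \<open>g\<^sub>0 (w\<^sub>k\<^sub>+\<^sub>1 - v\<^sub>k) = \<epsilon>\<^sub>- g\<^sub>k\<^sub>+\<^sub>1\<close>, with \<open>v\<^sub>0 = \<epsilon>\<^sub>+\<close> and
  \<open>w\<^sub>0 = \<epsilon>\<^sub>-\<close>. Both are one fact about alternating sums, \<open>alt_conv_Suc\<close>: splitting off the term
  \<open>m = 0\<close> shifts the index, which exchanges the two parity classes. Descent to the quotient is
  \<open>char_descends\<close>.
\<close>

text \<open>
  The extension of an assignment \<open>f\<close> of complex numbers to the generators to a character of the
  free algebra: a word is sent to the product of the values of its letters.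
\<close>

definition eval_free :: "('a \<Rightarrow> complex) \<Rightarrow> 'a free_alg \<Rightarrow> complex" where
  "eval_free f p =
     (\<Sum>w\<in>Poly_Mapping.keys p. Poly_Mapping.lookup p w * prod_list (map f (letters w)))"

lemma eval_free_superset:
  assumes "finite S" "Poly_Mapping.keys p \<subseteq> S"
  shows "eval_free f p = (\<Sum>w\<in>S. Poly_Mapping.lookup p w * prod_list (map f (letters w)))"
  unfolding eval_free_def
  by (rule sum.mono_neutral_left) (use assms in \<open>auto simp: in_keys_iff\<close>)

lemma eval_free_single [simp]:
  "eval_free f (Poly_Mapping.single w c) = c * prod_list (map f (letters w))"
  by (subst eval_free_superset[of "{w}"]) auto

lemma eval_free_0 [simp]: "eval_free f 0 = 0"
  by (simp add: eval_free_def)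

lemma eval_free_add [simp]: "eval_free f (p + r) = eval_free f p + eval_free f r"
proof -
  let ?S = "Poly_Mapping.keys p \<union> Poly_Mapping.keys r"
  have "Poly_Mapping.keys (p + r) \<subseteq> ?S"
    by (rule Poly_Mapping.keys_add)
  then show ?thesis
    by (simp add: eval_free_superset[of ?S] lookup_add algebra_simps sum.distrib)
qed

lemma eval_free_diff [simp]: "eval_free f (p - r) = eval_free f p - eval_free f r"
  using eval_free_add[of f "p - r" r] by simp

lemma letters_add [simp]: "letters (u + v) = letters u @ letters v"
  by (simp add: plus_word_def)

lemma letters_0 [simp]: "letters 0 = []"
  by (simp add: zero_word_def)

lemma free_alg_induct [case_names single add]:
  fixes p :: "'a free_alg"
  assumes single: "\<And>w c. P (Poly_Mapping.single w c)"
    and add: "\<And>p r. P p \<Longrightarrow> P r \<Longrightarrow> P (p + r)"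
  shows "P p"
proof (induction p rule: update_induct)
  case const
  show ?case
    using single[of 0 0] by simp
next
  case (update p w c)
  have "Poly_Mapping.update w c p = p + Poly_Mapping.single w c"
    using update(1)
    by (intro poly_mapping_eqI)
      (auto simp: lookup_update lookup_add lookup_single in_keys_iff)
  with add[OF update(3) single[of w c]] show ?case
    by simp
qed

lemma eval_free_mult [simp]: "eval_free f (p * r) = eval_free f p * eval_free f r"
proof (induction p rule: free_alg_induct)
  case (single w c)
  show ?case
    by (induction r rule: free_alg_induct) (simp_all add: mult_single distrib_left)
next
  case (add p p')
  then show ?case
    by (simp add: distrib_right)
qed

lemma eval_free_1 [simp]: "eval_free f 1 = 1"
  by (simp flip: single_one)

lemma eval_free_gen [simp]: "eval_free f (free_gen x) = f x"
  by (simp add: free_gen_def)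

lemma eval_free_scalar [simp]: "eval_free f (scalar c) = c"
  by (simp add: scalar_def)

lemma eval_free_comm [simp]: "eval_free f (comm p r) = 0"
  by (simp add: comm_def)

lemma eval_free_qcomm [simp]:
  "eval_free f (qcomm q p r) = (q - inverse q) * (eval_free f p * eval_free f r)"
  by (simp add: qcomm_def algebra_simps)

lemma complex_alg_ring: "ring complex_alg"
proof unfold_locales
  have "\<exists>y. y + x = 0 \<and> x + y = 0" for x :: complex
    by (intro exI[of _ "- x"]) simp
  then show "carrier (add_monoid complex_alg) \<subseteq> Units (add_monoid complex_alg)"
    by (auto simp: Units_def complex_alg_def)
qed (auto simp: complex_alg_def algebra_simps)

lemma eval_free_ring_hom: "ring_hom_ring ring_of_type_algebra complex_alg (eval_free f)"
  by (intro ring_hom_ringI free_alg_ring complex_alg_ring)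
    (auto simp: ring_of_type_algebra_def complex_alg_def)

lemma eval_free_eq_0_on_Aq_ideal:
  assumes rel: "\<And>x y. Aq_rel q kp km x y \<Longrightarrow> eval_free f x = eval_free f y"
    and "x \<in> Aq_ideal q kp km"
  shows "eval_free f x = 0"
proof -
  let ?K = "a_kernel ring_of_type_algebra complex_alg (eval_free f)"
  have K: "?K = {x. eval_free f x = 0}"
    by (simp add: a_kernel_def' ring_of_type_algebra_def complex_alg_def)
  have "ideal ?K ring_of_type_algebra"
    by (rule ring_hom_ring.kernel_is_ideal[OF eval_free_ring_hom])
  then have "Aq_ideal q kp km \<subseteq> ?K"
    unfolding Aq_ideal_def
    by (rule ring.genideal_minimal[OF free_alg_ring]) (auto simp: K rel)
  with assms(2) K show ?thesis
    by auto
qed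

text \<open>The universal property of \<open>\<A>\<^sub>q\<close> for maps to \<open>\<complex>\<close>.\<close>

lemma char_descends:
  assumes rel: "\<And>x y. Aq_rel q kp km x y \<Longrightarrow> eval_free f x = eval_free f y"
  obtains h where "h \<in> alg_hom (Aq q kp km) complex_alg"
    and "\<And>x. h (Aq_class q kp km x) = eval_free f x"
proof -
  let ?F = "ring_of_type_algebra :: gen free_alg ring"
  let ?cl = "Aq_class q kp km"
  interpret I: ideal "Aq_ideal q kp km" ?F
    by (rule Aq_ideal_ideal)
  define h where "h C = the_elem (eval_free f ` C)" for C
  have h_class: "h (?cl x) = eval_free f x" for x
  proof -
    have "eval_free f z = eval_free f x" if "z \<in> ?cl x" for z
      using that eval_free_eq_0_on_Aq_ideal[OF rel]
      by (auto simp: Aq_class_def a_r_coset_def r_coset_def ring_of_type_algebra_def)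
    moreover have "x \<in> ?cl x"
      using I.a_rcos_self[of x] by (simp add: Aq_class_def ring_of_type_algebra_def)
    ultimately have "eval_free f ` ?cl x = {eval_free f x}"
      by blast
    then show ?thesis
      by (simp add: h_def)
  qed
  have carrier: "carrier (Aq q kp km) = range ?cl"
    by (auto simp: Aq_def Let_def FactRing_def Aq_class_def A_RCOSETS_def'
        ring_of_type_algebra_def)
  have mult: "?cl x \<otimes>\<^bsub>Aq q kp km\<^esub> ?cl y = ?cl (x * y)" for x y
    using I.rcoset_mult_add[of x y]
    by (simp add: Aq_def Let_def FactRing_def Aq_class_def ring_of_type_algebra_def)
  have add: "?cl x \<oplus>\<^bsub>Aq q kp km\<^esub> ?cl y = ?cl (x + y)" for x y
    using I.a_rcos_sum[of x y]
    by (simp add: Aq_def Let_def FactRing_def Aq_class_def ring_of_type_algebra_def)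
  have one: "\<one>\<^bsub>Aq q kp km\<^esub> = ?cl 1"
    by (simp add: Aq_def Let_def FactRing_def Aq_class_def ring_of_type_algebra_def)
  have "h \<in> ring_hom (Aq q kp km) complex_alg"
    by (rule ring_hom_memI) (auto simp: carrier mult add one h_class complex_alg_def)
  then have "h \<in> alg_hom (Aq q kp km) complex_alg"
    by (auto simp: alg_hom_def carrier Aq_smult_class h_class complex_alg_def)
  with h_class show thesis
    using that by blast
qed

text \<open>
  The sum in the formula for the character: \<open>a\<close> weights the even and \<open>b\<close> the odd values of the
  summation index.
\<close>

definition alt_conv :: "'a::comm_semiring_1 \<Rightarrow> 'a \<Rightarrow> (nat \<Rightarrow> 'a) \<Rightarrow> nat \<Rightarrow> 'a" where
  "alt_conv a b g k = (\<Sum>m=0..k. (of_nat (m mod 2) * b + of_nat ((m + 1) mod 2) * a) * g (k - m))"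

lemma alt_conv_0 [simp]: "alt_conv a b g 0 = a * g 0"
  by (simp add: alt_conv_def)

lemma alt_conv_Suc: "alt_conv a b g (Suc k) = a * g (Suc k) + alt_conv b a g k"
  unfolding alt_conv_def
  by (simp add: sum.atLeast0_atMost_Suc_shift add.commute del: sum.cl_ivl_Suc)

theorem proposition2p7:
  fixes q kp km ep em :: complex and g :: "nat \<Rightarrow> complex"
  assumes "q \<noteq> 0"
    and "\<And>n::nat. n > 0 \<Longrightarrow> q ^ n \<noteq> 1"
    and "kp \<noteq> 0" and "km \<noteq> 0"
    and "g 0 = rho q kp km / (q - inverse q)"
  shows "\<exists>h \<in> alg_hom (Aq q kp km) complex_alg. \<forall>k::nat.
     h (G_A q kp km k) = g (k + 1) \<and>
     h (Gt_A q kp km k) = g (k + 1) \<and>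
     h (W_A q kp km (int k + 1)) = inverse (g 0) *
       (\<Sum>m=0..k. (of_nat (m mod 2) * ep + of_nat ((m + 1) mod 2) * em) * g (k - m)) \<and>
     h (W_A q kp km (- int k)) = inverse (g 0) *
       (\<Sum>m=0..k. (of_nat (m mod 2) * em + of_nat ((m + 1) mod 2) * ep) * g (k - m))"
proof -
  \<comment> \<open>The hypothesis on \<open>q\<close> enters only through \<open>q\<^sup>4 \<noteq> 1\<close>, which makes both factors below nonzero.\<close>
  have "q ^ 4 \<noteq> 1"
    using assms(2)[of 4] by simp
  moreover have "q ^ 4 - 1 = (q * (q + inverse q)) * (q * (q - inverse q))"
  proof -
    have "q * (q + inverse q) = q\<^sup>2 + 1" "q * (q - inverse q) = q\<^sup>2 - 1"
      using assms(1) by (simp_all add: distrib_left right_diff_distrib power2_eq_square)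
    then show ?thesis
      by (simp only:) (simp add: algebra_simps flip: power_add)
  qed
  ultimately have qm: "q - inverse q \<noteq> 0" and qp: "q + inverse q \<noteq> 0"
    by (metis mult_zero_left mult_zero_right eq_iff_diff_eq_0)+
  have rho: "rho q kp km = g 0 * (q - inverse q)"
    using assms(5) qm by simp
  have g0: "g 0 \<noteq> 0"
    using assms(3-5) qm qp by (simp add: rho_def)
  \<comment> \<open>Nonpositive indices carry the sums with leading coefficient \<open>ep\<close>, positive ones those with \<open>em\<close>.\<close>
  define wval where "wval n = inverse (g 0) *
    (if n \<le> 0 then alt_conv ep em g (nat (- n)) else alt_conv em ep g (nat (n - 1)))" for n
  define f where "f x = (case x of W n \<Rightarrow> wval n | G k \<Rightarrow> g (k + 1) | Gt k \<Rightarrow> g (k + 1))" for x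
  have f_G: "f (G k) = g (k + 1)" and f_Gt: "f (Gt k) = g (k + 1)" for k
    by (simp_all add: f_def)
  have f_pos: "f (W (int k + 1)) = inverse (g 0) * alt_conv em ep g k" for k
    by (simp add: f_def wval_def)
  have f_neg: "f (W (- int k)) = inverse (g 0) * alt_conv ep em g k" for k
    by (simp add: f_def wval_def)
  have f_0: "f (W 0) = ep" and f_1: "f (W 1) = em"
    using f_neg[of 0] f_pos[of 0] g0 by simp_all
  have rec_neg: "rho q kp km * (f (W (- int k - 1)) - f (W (int k + 1))) =
      (q - inverse q) * (ep * g (k + 1))" for k
  proof -
    have "- int k - 1 = - int (Suc k)"
      by simp
    then have "g 0 * (f (W (- int k - 1)) - f (W (int k + 1))) = ep * g (k + 1)"
      using g0 by (simp only: f_neg f_pos alt_conv_Suc) (simp add: field_simps)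
    then show ?thesis
      by (simp add: rho mult.assoc mult.left_commute)
  qed
  have rec_pos: "rho q kp km * (f (W (int k + 2)) - f (W (- int k))) =
      (q - inverse q) * (em * g (k + 1))" for k
  proof -
    have "int k + 2 = int (Suc k) + 1"
      by simp
    then have "g 0 * (f (W (int k + 2)) - f (W (- int k))) = em * g (k + 1)"
      using g0 by (simp only: f_neg f_pos alt_conv_Suc) (simp add: field_simps)
    then show ?thesis
      by (simp add: rho mult.assoc mult.left_commute)
  qed
  have rel: "eval_free f x = eval_free f y" if "Aq_rel q kp km x y" for x y
    using that
    by cases (simp_all add: f_G f_Gt f_0 f_1 rec_neg rec_pos mult.commute)
  obtain h where h: "h \<in> alg_hom (Aq q kp km) complex_alg"
    and h_class: "\<And>x. h (Aq_class q kp km x) = eval_free f x"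
    using char_descends[OF rel] by blast
  show ?thesis
    by (rule bexI[OF _ h]) (simp add: h_class f_G f_Gt f_pos f_neg alt_conv_def)
qed

end
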